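(* Let $G$ be a completable graph and $\Sigma(G)$ a real $G$-partial positive definite matrix. Let $f_0,f_1$ be zero-mean multivariate Gaussian densities on $\mathbb{R}^n$ with covariance matrices $\Sigma_0,\Sigma_1\in\mathfrak{p}^+[\Sigma(G)]$ respectively. Then: (1) $H(f_1)-H(f_0)=\frac12\int_0^1\operatorname{tr}\big(\Sigma(\lambda)^{-1}(\Sigma_1-\Sigma_0)\big)\,d\lambda$, where $\Sigma(\lambda)=(1-\lambda)\Sigma_0+\lambda\Sigma_1$; (2) for $t\in[0,1]$, if $f_0\#_tf_1$ denotes the zero-mean multivariate Gaussian density on $\mathbb{R}^n$ with covariance matrix $\Sigma_0\#_t\Sigma_1$, then $H(f_0\#_tf_1)=(1-t)H(f_0)+tH(f_1)$.
   Context: A graph $G=(V,E)$ is a finite undirected graph on $V=\{1,\dots,n\}$ containing all loops. A $G$-partial matrix has entries specified exactly for $\{i,j\}\in E$; a completion agrees with it on $E$. It is partial positive definite if it is symmetric on $E$ and every principal submatrix indexed by a clique of $G$ is positive definite. $G$ is completable if every $G$-partial positive semidefinite matrix has a positive semidefinite completion (equivalently $G$ chordal). $\mathfrak{p}^+[\Sigma(G)]$ is the set of positive definite completions. The zero-mean Gaussian density with covariance $\Sigma$ is $f(x)=(2\pi)^{-n/2}(\det\Sigma)^{-1/2}\exp\{-\frac12x^\top\Sigma^{-1}x\}$, and its Shannon entropy is $H(f)=-\int_{\mathbb{R}^n}f(x)\log f(x)\,dx$. For positive definite $A,B$, $A\#_tB:=A^{1/2}(A^{-1/2}BA^{-1/2})^tA^{1/2}$.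 *)

theory Defs
  imports "HOL-Analysis.Analysis"
begin

definition is_graph :: "('n::finite \<times> 'n) set \<Rightarrow> bool" where
  "is_graph E \<longleftrightarrow> (\<forall>i. (i, i) \<in> E) \<and> (\<forall>i j. (i, j) \<in> E \<longrightarrow> (j, i) \<in> E)"

definition is_clique :: "('n::finite \<times> 'n) set \<Rightarrow> 'n set \<Rightarrow> bool" where
  "is_clique E C \<longleftrightarrow> (\<forall>i\<in>C. \<forall>j\<in>C. (i, j) \<in> E)"

definition psd_on :: "'n set \<Rightarrow> real^'n^'n \<Rightarrow> bool" where
  "psd_on C A \<longleftrightarrow> (\<forall>i\<in>C. \<forall>j\<in>C. A $ i $ j = A $ j $ i) \<and>
     (\<forall>x::real^'n. (\<forall>i. i \<notin> C \<longrightarrow> x $ i = 0) \<longrightarrow> 0 \<le> (\<Sum>i\<in>C. \<Sum>j\<in>C. x $ i * A $ i $ j * x $ j))"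

definition pd_on :: "'n set \<Rightarrow> real^'n^'n \<Rightarrow> bool" where
  "pd_on C A \<longleftrightarrow> (\<forall>i\<in>C. \<forall>j\<in>C. A $ i $ j = A $ j $ i) \<and>
     (\<forall>x::real^'n. (\<forall>i. i \<notin> C \<longrightarrow> x $ i = 0) \<longrightarrow> x \<noteq> 0 \<longrightarrow> 0 < (\<Sum>i\<in>C. \<Sum>j\<in>C. x $ i * A $ i $ j * x $ j))"

abbreviation psd_matrix :: "real^'n::finite^'n \<Rightarrow> bool" where
  "psd_matrix A \<equiv> psd_on UNIV A"

abbreviation pd_matrix :: "real^'n::finite^'n \<Rightarrow> bool" where
  "pd_matrix A \<equiv> pd_on UNIV A"

text \<open>A G-partial matrix is represented by a full matrix whose entries outside E are ignored.\<close>
definition partial_symmetric :: "('n::finite \<times> 'n) set \<Rightarrow> real^'n^'n \<Rightarrow> bool" where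
  "partial_symmetric E P \<longleftrightarrow> (\<forall>i j. (i, j) \<in> E \<longrightarrow> P $ i $ j = P $ j $ i)"

definition partial_psd :: "('n::finite \<times> 'n) set \<Rightarrow> real^'n^'n \<Rightarrow> bool" where
  "partial_psd E P \<longleftrightarrow> partial_symmetric E P \<and> (\<forall>C. is_clique E C \<longrightarrow> psd_on C P)"

definition partial_pd :: "('n::finite \<times> 'n) set \<Rightarrow> real^'n^'n \<Rightarrow> bool" where
  "partial_pd E P \<longleftrightarrow> partial_symmetric E P \<and> (\<forall>C. is_clique E C \<longrightarrow> pd_on C P)"

definition is_completion :: "('n::finite \<times> 'n) set \<Rightarrow> real^'n^'n \<Rightarrow> real^'n^'n \<Rightarrow> bool" where
  "is_completion E P M \<longleftrightarrow> (\<forall>i j. (i, j) \<in> E \<longrightarrow> M $ i $ j = P $ i $ j)"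

definition completable :: "('n::finite \<times> 'n) set \<Rightarrow> bool" where
  "completable E \<longleftrightarrow> (\<forall>P. partial_psd E P \<longrightarrow> (\<exists>M. is_completion E P M \<and> psd_matrix M))"

definition pd_completions :: "('n::finite \<times> 'n) set \<Rightarrow> real^'n^'n \<Rightarrow> (real^'n^'n) set" where
  "pd_completions E P = {M. is_completion E P M \<and> pd_matrix M}"

definition diag_mat :: "real^'n::finite \<Rightarrow> real^'n^'n" where
  "diag_mat d = (\<chi> i j. if i = j then d $ i else 0)"

text \<open>Real powers of a positive definite matrix via its spectral decomposition
  A = Q diag(d) Q^T (well defined, independent of the decomposition).\<close>
definition mat_powr :: "real^'n::finite^'n \<Rightarrow> real \<Rightarrow> real^'n^'n" where
  "mat_powr A t = (SOME P. \<exists>Q d. orthogonal_matrix Q \<and> (\<forall>i. 0 < d $ i) \<and>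
      A = Q ** diag_mat d ** transpose Q \<and> P = Q ** diag_mat (\<chi> i. d $ i powr t) ** transpose Q)"

definition geo_mean :: "real^'n::finite^'n \<Rightarrow> real \<Rightarrow> real^'n^'n \<Rightarrow> real^'n^'n" where
  "geo_mean A t B = mat_powr A (1/2) **
      mat_powr (mat_powr A (-1/2) ** B ** mat_powr A (-1/2)) t ** mat_powr A (1/2)"

definition gauss_density :: "real^'n::finite^'n \<Rightarrow> real^'n \<Rightarrow> real" where
  "gauss_density S x = (2 * pi) powr (- real CARD('n) / 2) * det S powr (-1/2) *
      exp (- (1/2) * (x \<bullet> (matrix_inv S *v x)))"

definition entropy :: "('a::euclidean_space \<Rightarrow> real) \<Rightarrow> real" where
  "entropy f = - (\<integral>x. f x * ln (f x) \<partial>lborel)"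

end

theory Submission
  imports Defs "HOL-Probability.Distributions"
begin

text \<open>
  Writing a positive definite covariance as \<open>S = Q D Q\<^sup>T\<close>, the substitution \<open>x = Q D\<^sup>1\<^sup>/\<^sup>2 z\<close>
  reduces the entropy of the Gaussian with covariance \<open>S\<close> to that of the standard Gaussian plus
  \<open>1/2 ln (det S)\<close>. Part (2) then follows from \<open>det (A #\<^sub>t B) = (det A)\<^sup>1\<^sup>-\<^sup>t (det B)\<^sup>t\<close>. For part (1),
  diagonalise both matrices by one congruence, \<open>A = K K\<^sup>T\<close> and \<open>B = K diag(d) K\<^sup>T\<close>: the integrand
  becomes the sum of the \<open>(d\<^sub>i - 1) / (1 - l + l d\<^sub>i)\<close>, whose integral is the sum of the \<open>ln d\<^sub>i\<close>.
\<close>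

section \<open>Spectral theorem for self-adjoint maps\<close>

text \<open>Rayleigh quotient argument: \<open>x \<bullet> f x\<close> attains its maximum on the
  compact unit sphere of \<open>S\<close>. The maximiser is an eigenvector and the maximum its
  eigenvalue, because the residual \<open>w\<close> is a direction along which the first-order
  condition forces \<open>w \<bullet> w = 0\<close>.\<close>

lemma selfadjoint_eigenvector_exists:
  fixes f :: "'a::euclidean_space \<Rightarrow> 'a"
  assumes "linear f" and selfadj: "\<And>x y. f x \<bullet> y = x \<bullet> f y"
    and S: "subspace S" "f ` S \<subseteq> S" "S \<noteq> {0}"
  obtains u c where "u \<in> S" "norm u = 1" "f u = c *\<^sub>R u"
proof -
  interpret linear f by fact
  let ?K = "S \<inter> sphere 0 1"
  have "compact ?K"
    using S(1) by (simp add: closed_subspace closed_Int_compact)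
  moreover have "?K \<noteq> {}"
  proof -
    obtain x where "x \<in> S" "x \<noteq> 0"
      using S(1,3) subspace_0 by blast
    then have "inverse (norm x) *\<^sub>R x \<in> ?K"
      using S(1) by (simp add: subspace_scale)
    then show ?thesis by blast
  qed
  moreover have "continuous_on ?K (\<lambda>x. x \<bullet> f x)"
    using \<open>linear f\<close> by (intro continuous_intros linear_continuous_on linear_conv_bounded_linear[THEN iffD1])
  ultimately obtain u where u: "u \<in> ?K" and max: "\<And>y. y \<in> ?K \<Longrightarrow> y \<bullet> f y \<le> u \<bullet> f u"
    using continuous_attains_sup by metis
  define c where "c = u \<bullet> f u"
  define w where "w = c *\<^sub>R u - f u"
  have uu: "u \<bullet> u = 1"
    using u by (simp add: dot_square_norm)
  \<comment> \<open>Both sides are homogeneous of degree two, so the bound on the unit sphere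
    extends to all of \<open>S\<close>.\<close>
  have le: "y \<bullet> f y \<le> c * (y \<bullet> y)" if "y \<in> S" for y
  proof (cases "y = 0")
    case False
    then have "inverse (norm y) *\<^sub>R y \<in> ?K"
      using S(1) that by (simp add: subspace_scale)
    from max[OF this] have "inverse (norm y) * (inverse (norm y) * (y \<bullet> f y)) \<le> c"
      by (simp add: scale c_def)
    with False have "y \<bullet> f y \<le> c * (norm y * norm y)"
      by (simp add: field_simps)
    then show ?thesis
      by (simp add: dot_square_norm power2_eq_square)
  qed (simp add: zero)
  have "w \<in> S"
    using S(1,2) u unfolding w_def by (intro subspace_diff subspace_scale) auto
  \<comment> \<open>The form \<open>c (y \<bullet> y) - y \<bullet> f y\<close> is nonnegative on \<open>S\<close> and vanishes at \<open>u\<close>, hence its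
    derivative at \<open>u\<close> in the direction \<open>w\<close> vanishes.\<close>
  have quad: "0 \<le> 2 * t * (w \<bullet> w) + t\<^sup>2 * (c * (w \<bullet> w) - w \<bullet> f w)" for t
  proof -
    have "u + t *\<^sub>R w \<in> S"
      using u S(1) \<open>w \<in> S\<close> by (intro subspace_add subspace_scale) auto
    from le[OF this] have "0 \<le> c * ((u + t *\<^sub>R w) \<bullet> (u + t *\<^sub>R w)) - (u + t *\<^sub>R w) \<bullet> f (u + t *\<^sub>R w)"
      by simp
    also have "\<dots> = 2 * t * (c * (u \<bullet> w) - f u \<bullet> w) + t\<^sup>2 * (c * (w \<bullet> w) - w \<bullet> f w)"
      by (simp add: add scale inner_add inner_commute[of w u] inner_commute[of w "f u"]
          selfadj[of u w] uu c_def[symmetric] power2_eq_square algebra_simps)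
    also have "c * (u \<bullet> w) - f u \<bullet> w = w \<bullet> w"
      by (simp add: w_def inner_diff_left)
    finally show ?thesis .
  qed
  have "w = 0"
  proof (rule ccontr)
    assume "w \<noteq> 0"
    define a where "a = w \<bullet> w"
    \<comment> \<open>\<open>b\<close> is a positive upper bound for the quadratic coefficient. The
      step \<open>t = -(a/b)\<close> used below minimises \<open>2 * t * a + t\<^sup>2 * b\<close>,
      with the negative value \<open>-(a * a / b)\<close>.\<close>
    define b where "b = \<bar>c * (w \<bullet> w) - w \<bullet> f w\<bar> + 1"
    have "a > 0" "b > 0" "c * (w \<bullet> w) - w \<bullet> f w \<le> b"
      using \<open>w \<noteq> 0\<close> by (auto simp: a_def b_def)
    have "0 \<le> 2 * (-(a/b)) * a + (-(a/b))\<^sup>2 * (c * (w \<bullet> w) - w \<bullet> f w)"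
      using quad[of "-(a/b)"] by (simp add: a_def)
    also have "\<dots> \<le> 2 * (-(a/b)) * a + (-(a/b))\<^sup>2 * b"
      using \<open>c * (w \<bullet> w) - w \<bullet> f w \<le> b\<close> by (intro add_left_mono mult_left_mono) auto
    also have "\<dots> = - (a * a / b)"
      using \<open>b > 0\<close> by (simp add: field_simps power2_eq_square)
    finally have "a * a / b \<le> 0" by simp
    moreover have "0 < a * a / b"
      using \<open>a > 0\<close> \<open>b > 0\<close> by (intro divide_pos_pos mult_pos_pos)
    ultimately show False by simp
  qed
  then show ?thesis
    using u that[of u c] by (simp add: w_def)
qed

text \<open>Induction on the dimension: split off a unit eigenvector \<open>u\<close>.
  Self-adjointness keeps its orthogonal complement in \<open>S\<close> invariant, and that
  complement has dimension one less.\<close>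

theorem selfadjoint_orthonormal_eigenbasis:
  fixes f :: "'a::euclidean_space \<Rightarrow> 'a"
  assumes f: "linear f" and selfadj: "\<And>x y. f x \<bullet> y = x \<bullet> f y"
    and S: "subspace S" "f ` S \<subseteq> S"
  shows "\<exists>B\<subseteq>S. finite B \<and> card B = dim S \<and> pairwise orthogonal B
    \<and> (\<forall>b\<in>B. norm b = 1 \<and> (\<exists>c. f b = c *\<^sub>R b))"
  using S
proof (induction "dim S" arbitrary: S)
  case 0
  then show ?case by (intro exI[of _ "{}"]) auto
next
  case (Suc n)
  interpret linear f by fact
  have "S \<noteq> {0}"
    using Suc.hyps(2) by auto
  then obtain u c where u: "u \<in> S" "norm u = 1" "f u = c *\<^sub>R u"
    using selfadjoint_eigenvector_exists[OF f selfadj Suc.prems] by metis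
  define T where "T = {y \<in> S. orthogonal u y}"
  \<comment> \<open>Orthogonality to \<open>u\<close> is restated for the whole span, the form in
    which the dimension formula takes it.\<close>
  have "T = {y \<in> S. \<forall>x\<in>span {u}. orthogonal x y}"
    by (auto simp: T_def span_singleton orthogonal_clauses orthogonal_def dest: spec[of _ 1])
  moreover have "span {u} \<subseteq> S"
    using u Suc.prems(1) by (simp add: span_minimal)
  ultimately have "dim T + dim (span {u}) = dim S"
    using dim_subspace_orthogonal_to_vectors[OF subspace_span Suc.prems(1)] by metis
  moreover have "dim (span {u}) = 1"
    using u(2) by auto
  ultimately have "n = dim T"
    using Suc.hyps(2) by simp
  moreover have "subspace T"
    using Suc.prems(1) unfolding T_def subspace_def by (auto simp: orthogonal_clauses)
  moreover have "f ` T \<subseteq> T"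
  proof clarify
    fix y assume "y \<in> T"
    then show "f y \<in> T"
      using Suc.prems(2) selfadj[of u y] u(3) by (auto simp: T_def orthogonal_def)
  qed
  ultimately obtain B where B: "B \<subseteq> T" "finite B" "card B = dim T" "pairwise orthogonal B"
    "\<forall>b\<in>B. norm b = 1 \<and> (\<exists>c. f b = c *\<^sub>R b)"
    using Suc.hyps(1) by metis
  have "u \<notin> B"
    using B(1) u(2) by (auto simp: T_def orthogonal_def)
  then have "card (insert u B) = dim S"
    using B Suc.hyps(2) \<open>n = dim T\<close> by simp
  moreover have "pairwise orthogonal (insert u B)"
    using B(1,4) unfolding pairwise_insert by (auto simp: T_def orthogonal_commute)
  ultimately show ?case
    using B u by (intro exI[of _ "insert u B"]) (auto simp: T_def)
qed

section \<open>Rotation invariance of Lebesgue measure and Gaussian integrals\<close>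

lemma distr_lborel_orthogonal_transformation:
  fixes f :: "'a::euclidean_space \<Rightarrow> 'a"
  assumes f: "orthogonal_transformation f"
  shows "distr lborel borel f = lborel"
proof -
  have "linear f" and norm_f: "\<And>x. norm (f x) = norm x"
    using f by (auto simp: orthogonal_transformation)
  have [measurable]: "f \<in> borel_measurable borel"
    by (intro borel_measurable_continuous_onI linear_continuous_on
        linear_conv_bounded_linear[THEN iffD1] \<open>linear f\<close>)
  define b where "b = (indicator (ball 0 1) :: 'a \<Rightarrow> ennreal)"
  have [measurable]: "b \<in> borel_measurable borel"
    unfolding b_def by (intro borel_measurable_indicator borel_open open_ball)
  define \<beta> where "\<beta> = (\<integral>\<^sup>+x. b x \<partial>lborel)"
  have "\<beta> = emeasure lborel (ball (0::'a) 1)"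
    by (simp add: \<beta>_def b_def)
  then have \<beta>: "\<beta> \<noteq> 0" "\<beta> \<noteq> \<infinity>"
    using emeasure_lborel_ball_finite[of "0::'a" 1] content_ball_pos[of 1 "0::'a"]
    by (auto simp: measure_def)
  have shift: "(\<integral>\<^sup>+x. h (a + x) \<partial>lborel) = (\<integral>\<^sup>+x. h x \<partial>lborel)"
    if [measurable]: "h \<in> borel_measurable borel" for h :: "'a \<Rightarrow> ennreal" and a
    by (subst (2) lborel_distr_plus[of a, symmetric]) (simp add: nn_integral_distr)
  \<comment> \<open>Uniqueness of the translation-invariant measure by Fubini; the ball makes the
    constant explicit because its indicator is invariant under \<open>f\<close>.\<close>
  have eq: "(\<integral>\<^sup>+y. g (f y) \<partial>lborel) = (\<integral>\<^sup>+x. g x \<partial>lborel)"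
    if [measurable]: "g \<in> borel_measurable borel" for g :: "'a \<Rightarrow> ennreal"
  proof -
    \<comment> \<open>Surjectivity lets every translation in the image be written as
      \<open>f z\<close>; by linearity it becomes a translation by \<open>z\<close> of the argument
      of \<open>f\<close>.\<close>
    have surj: "\<exists>z. x = f z" for x
      using orthogonal_transformation_surj[OF f] by (auto simp: surj_def)
    have 1: "(\<integral>\<^sup>+y. g (x + f y) \<partial>lborel) = (\<integral>\<^sup>+y. g (f y) \<partial>lborel)" for x
    proof -
      obtain z where z: "x = f z" using surj by blast
      show ?thesis
        using shift[of "\<lambda>y. g (f y)" z] by (simp add: z linear_add[OF \<open>linear f\<close>])
    qed
    have 2: "(\<integral>\<^sup>+y. b (x - f y) \<partial>lborel) = \<beta>" for x
    proof -
      obtain z where z: "x = f z" using surj by blast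
      have "b (x - f y) = b (- z + y)" for y
        using norm_f[of "z - y"] by (simp add: b_def z linear_diff[OF \<open>linear f\<close>] indicator_def norm_minus_commute)
      then show ?thesis
        using shift[of b "-z"] by (simp add: \<beta>_def)
    qed
    \<comment> \<open>The double integral of \<open>b x * g (x + f y)\<close> is evaluated in two
      orders. Integrating in \<open>y\<close> first gives the left side; shifting \<open>x\<close>
      by \<open>f y\<close> and then integrating in \<open>y\<close> leaves \<beta> times the
      integral of \<open>g\<close>. Since \<beta> is neither zero nor infinite, it cancels.\<close>
    have "\<beta> * (\<integral>\<^sup>+y. g (f y) \<partial>lborel) = (\<integral>\<^sup>+x. b x * (\<integral>\<^sup>+y. g (f y) \<partial>lborel) \<partial>lborel)"
      by (simp add: \<beta>_def nn_integral_multc)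
    also have "\<dots> = (\<integral>\<^sup>+x. (\<integral>\<^sup>+y. b x * g (x + f y) \<partial>lborel) \<partial>lborel)"
      by (simp add: 1 nn_integral_cmult)
    also have "\<dots> = (\<integral>\<^sup>+y. (\<integral>\<^sup>+x. b x * g (x + f y) \<partial>lborel) \<partial>lborel)"
      by (rule lborel_pair.Fubini') measurable
    also have "\<dots> = (\<integral>\<^sup>+y. (\<integral>\<^sup>+x. b (x - f y) * g x \<partial>lborel) \<partial>lborel)"
    proof (rule nn_integral_cong)
      fix y
      show "(\<integral>\<^sup>+x. b x * g (x + f y) \<partial>lborel) = (\<integral>\<^sup>+x. b (x - f y) * g x \<partial>lborel)"
        using shift[of "\<lambda>x. b (x - f y) * g x" "f y"] by (simp add: add.commute)
    qed
    also have "\<dots> = (\<integral>\<^sup>+x. (\<integral>\<^sup>+y. b (x - f y) * g x \<partial>lborel) \<partial>lborel)"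
      by (rule lborel_pair.Fubini') measurable
    also have "\<dots> = (\<integral>\<^sup>+x. \<beta> * g x \<partial>lborel)"
      by (simp add: 2 nn_integral_multc)
    also have "\<dots> = \<beta> * (\<integral>\<^sup>+x. g x \<partial>lborel)"
      by (simp add: nn_integral_cmult)
    finally show ?thesis
      using \<beta> by (simp add: ennreal_mult_cancel_left)
  qed
  show ?thesis
  proof (rule measure_eqI)
    fix A assume "A \<in> sets (distr lborel borel f)"
    then have [measurable]: "A \<in> sets borel" by simp
    have "emeasure (distr lborel borel f) A = (\<integral>\<^sup>+y. indicator A (f y) \<partial>lborel)"
      by (simp add: emeasure_distr nn_integral_distr flip: nn_integral_indicator)
    then show "emeasure (distr lborel borel f) A = emeasure lborel A"
      by (simp add: eq)
  qed simp
qed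

section \<open>Gaussian integrals in one and in several dimensions\<close>

lemma has_bochner_integral_gaussian_real:
  fixes c :: real
  assumes "c > 0"
  shows "has_bochner_integral lborel (\<lambda>x. exp (- c * x\<^sup>2)) (sqrt (pi / c))"
proof -
  \<comment> \<open>The standard deviation for which the normal density is a constant multiple of
    \<open>exp (- c * x\<^sup>2)\<close>. Its zeroth moment below supplies integrability and total
    mass 1.\<close>
  define s where "s = sqrt (1 / (2 * c))"
  have s: "s > 0" "s\<^sup>2 = 1 / (2 * c)"
    using assms by (auto simp: s_def)
  have "has_bochner_integral lborel (\<lambda>x. sqrt (pi / c) * normal_density 0 s x) (sqrt (pi / c) * 1)"
    using normal_moment_even[OF s(1), of 0 0] by (intro has_bochner_integral_mult_right) simp
  moreover have "sqrt (pi / c) * normal_density 0 s x = exp (- c * x\<^sup>2)" for x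
    using assms by (simp add: normal_density_def s field_simps)
  ultimately show ?thesis by simp
qed

text \<open>Lebesgue measure is the image of a product measure under the coordinate map
  \<open>?T\<close>, and the exponential of a sum of squares is a product over the coordinates, so
  the integral factorises.\<close>

lemma has_bochner_integral_gaussian:
  fixes c :: real
  assumes "c > 0"
  shows "has_bochner_integral lborel (\<lambda>x::'a::euclidean_space. exp (- c * (x \<bullet> x)))
    (sqrt (pi / c) ^ DIM('a))"
proof -
  interpret product_sigma_finite "\<lambda>_::'a. lborel :: real measure"
    by standard
  let ?T = "\<lambda>f. \<Sum>b\<in>Basis. f b *\<^sub>R b :: 'a"
  let ?g = "\<lambda>x. exp (- c * x\<^sup>2) :: real"
  have 1: "integrable lborel ?g" "integral\<^sup>L lborel ?g = sqrt (pi / c)"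
    using has_bochner_integral_gaussian_real[OF assms] by (auto simp: has_bochner_integral_iff)
  have eq: "exp (- c * (?T x \<bullet> ?T x)) = (\<Prod>b\<in>Basis. ?g (x b))" for x
  proof -
    have "?T x \<bullet> ?T x = (\<Sum>b\<in>Basis. (?T x \<bullet> b) * (?T x \<bullet> b))"
      by (rule euclidean_inner)
    also have "\<dots> = (\<Sum>b\<in>Basis. (x b)\<^sup>2)"
      by (intro sum.cong) (auto simp: power2_eq_square)
    finally show ?thesis
      by (simp add: sum_distrib_left exp_sum flip: sum_negf)
  qed
  show ?thesis
    unfolding has_bochner_integral_iff
    using product_integrable_prod[of Basis "\<lambda>_. ?g"] product_integral_prod[of Basis "\<lambda>_. ?g"] 1
    by (subst (1 2) lborel_eq, subst integrable_distr_eq, (measurable)[2], subst integral_distr, (measurable)[2])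
      (simp only: eq, simp)
qed

section \<open>Positive definite matrices\<close>

lemma pd_matrix_iff:
  fixes A :: "real^'n::finite^'n"
  shows "pd_matrix A \<longleftrightarrow> transpose A = A \<and> (\<forall>x. x \<noteq> 0 \<longrightarrow> 0 < x \<bullet> (A *v x))"
proof -
  have "(\<Sum>i\<in>UNIV. \<Sum>j\<in>UNIV. x $ i * A $ i $ j * x $ j) = x \<bullet> (A *v x)" for x :: "real^'n"
    by (simp add: inner_vec_def matrix_vector_mult_def sum_distrib_left mult.assoc)
  moreover have "(\<forall>i j. A $ i $ j = A $ j $ i) \<longleftrightarrow> transpose A = A"
    by (auto simp: transpose_def vec_eq_iff)
  ultimately show ?thesis
    by (simp add: pd_on_def)
qed

lemma inner_matrix_vector_transpose:
  fixes A :: "real^'n^'m"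
  shows "x \<bullet> (A *v y) = (transpose A *v x) \<bullet> y"
  by (simp add: dot_lmul_matrix)

text \<open>For square matrices a right inverse is two-sided and unique, so the choice made by
  \<open>matrix_inv\<close> must be \<open>B\<close>.\<close>

lemma matrix_inv_eqI:
  fixes A B :: "real^'n::finite^'n"
  assumes "A ** B = mat 1"
  shows "matrix_inv A = B"
  unfolding matrix_inv_def
proof (rule some_equality)
  show "A ** B = mat 1 \<and> B ** A = mat 1"
    using assms by (simp add: matrix_left_right_inverse)
  show "C = B" if "A ** C = mat 1 \<and> C ** A = mat 1" for C
    using that assms by (metis matrix_mul_assoc matrix_mul_lid matrix_mul_rid)
qed

section \<open>Matrix algebra and diagonal matrices\<close>

lemma matrix_mul_add_left: "((A :: real^'n^'m) + B) ** C = A ** C + B ** C"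
  by (simp add: vec_eq_iff matrix_matrix_mult_def distrib_right sum.distrib)

lemma matrix_mul_scaleR: "(A :: real^'n^'m) ** (c *\<^sub>R B) = c *\<^sub>R (A ** B)"
  by (simp add: vec_eq_iff matrix_matrix_mult_def sum_distrib_left mult_ac)

lemma scaleR_matrix_mul: "(c *\<^sub>R (A :: real^'n^'m)) ** B = c *\<^sub>R (A ** B)"
  by (simp add: vec_eq_iff matrix_matrix_mult_def sum_distrib_left mult_ac)

lemma diag_mat_nth: "diag_mat d $ i $ j = (if i = j then d $ i else 0)"
  by (simp add: diag_mat_def)

lemma matrix_mul_diag_mat_nth: "(A ** diag_mat d) $ i $ j = A $ i $ j * d $ j"
  by (simp add: matrix_matrix_mult_def diag_mat_nth if_distrib [where f="\<lambda>x. _ * x"] cong: if_cong)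

lemma diag_mat_mult_vector_nth: "(diag_mat d *v x) $ i = d $ i * x $ i"
  by (simp add: matrix_vector_mult_def diag_mat_nth if_distrib [where f="\<lambda>y. y * _"] cong: if_cong)

lemma diag_mat_mult: "diag_mat c ** diag_mat d = diag_mat (\<chi> i. c $ i * d $ i)"
  by (auto simp: vec_eq_iff matrix_mul_diag_mat_nth diag_mat_nth)

lemma transpose_diag_mat [simp]: "transpose (diag_mat d) = diag_mat d"
  by (auto simp: vec_eq_iff transpose_def diag_mat_nth)

lemma det_diag_mat: "det (diag_mat d) = (\<Prod>i\<in>UNIV. d $ i)"
  by (subst det_diagonal) (auto simp: diag_mat_nth)

lemma trace_diag_mat: "trace (diag_mat d) = (\<Sum>i\<in>UNIV. d $ i)"
  by (simp add: trace_def diag_mat_nth)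

lemma diag_mat_1: "diag_mat (\<chi> i. 1) = mat 1"
  by (simp add: vec_eq_iff diag_mat_def mat_def)

lemma pd_diag_mat:
  fixes d :: "real^'n::finite"
  assumes "\<forall>i. 0 < d $ i"
  shows "pd_matrix (diag_mat d)"
proof -
  have "0 < x \<bullet> (diag_mat d *v x)" if "x \<noteq> 0" for x
  proof -
    from that obtain i where "x $ i \<noteq> 0"
      by (auto simp: vec_eq_iff)
    then have "0 < (\<Sum>i\<in>UNIV. d $ i * (x $ i)\<^sup>2)"
      using assms by (intro sum_pos2[of _ i]) (auto intro!: mult_nonneg_nonneg simp: less_imp_le)
    then show ?thesis
      by (simp add: inner_vec_def diag_mat_mult_vector_nth power2_eq_square mult_ac)
  qed
  then show ?thesis
    by (simp add: pd_matrix_iff)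
qed

text \<open>The quadratic form at \<open>x\<close> is that of \<open>A\<close> at
  \<open>transpose K *v x\<close>, which is nonzero because \<open>transpose K\<close> has trivial
  kernel.\<close>

lemma pd_matrix_congruence:
  fixes A K :: "real^'n::finite^'n"
  assumes "pd_matrix A" "invertible K"
  shows "pd_matrix (K ** A ** transpose K)"
proof -
  have "0 < x \<bullet> ((K ** A ** transpose K) *v x)" if "x \<noteq> 0" for x
  proof -
    have "invertible (transpose K)"
      using assms(2) by (simp add: invertible_det_nz)
    then have "transpose K *v x \<noteq> 0"
      using that by (metis invertible_left_inverse matrix_left_invertible_ker)
    then show ?thesis
      using assms(1)
      by (simp add: pd_matrix_iff inner_matrix_vector_transpose[of x K] flip: matrix_vector_mul_assoc del: transpose_matrix_vector)
  qed
  then show ?thesis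
    using assms(1) by (simp add: pd_matrix_iff matrix_transpose_mul matrix_mul_assoc)
qed

lemma orthogonal_matrix_imp_invertible: "orthogonal_matrix (Q :: real^'n::finite^'n) \<Longrightarrow> invertible Q"
  by (auto simp: orthogonal_matrix_def invertible_def)

text \<open>The columns of \<open>Q\<close> form an orthonormal eigenbasis of \<open>A\<close>. The
  eigenvalue of a unit eigenvector is the value of the quadratic form there, hence positive.\<close>

lemma pd_matrix_spectral:
  fixes A :: "real^'n::finite^'n"
  assumes "pd_matrix A"
  shows "\<exists>Q d. orthogonal_matrix Q \<and> (\<forall>i. 0 < d $ i) \<and> A = Q ** diag_mat d ** transpose Q"
proof -
  have A: "transpose A = A" "\<And>x. x \<noteq> 0 \<Longrightarrow> 0 < x \<bullet> (A *v x)"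
    using assms by (auto simp: pd_matrix_iff)
  have "(A *v x) \<bullet> y = x \<bullet> (A *v y)" for x y
    by (subst inner_matrix_vector_transpose) (simp only: A)
  from selfadjoint_orthonormal_eigenbasis[of "(*v) A" UNIV, OF _ this]
  obtain B :: "(real^'n) set" where B: "finite B" "card B = CARD('n)" "pairwise orthogonal B"
    "\<forall>b\<in>B. norm b = 1 \<and> (\<exists>c. A *v b = c *\<^sub>R b)"
    by (auto simp: dim_UNIV)
  \<comment> \<open>The basis is only a set; the bijection indexes it by the type of the matrix
    indices, so that its vectors can serve as columns.\<close>
  obtain q where q: "bij_betw q (UNIV :: 'n set) B"
    using B(1,2) finite_same_card_bij[of "UNIV :: 'n set" B] by auto
  have qB: "q i \<in> B" for i
    using q by (auto simp: bij_betw_def)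
  have "\<forall>i. \<exists>c. A *v q i = c *\<^sub>R q i"
    using B(4) qB by blast
  from choice[OF this] obtain c where c: "\<And>i. A *v q i = c i *\<^sub>R q i"
    by blast
  define Q :: "real^'n^'n" where "Q = (\<chi> i j. q j $ i)"
  define d where "d = (\<chi> i. c i)"
  have col: "column j Q = q j" for j
    by (simp add: Q_def column_def)
  have Q: "orthogonal_matrix Q"
    unfolding orthogonal_matrix_orthonormal_columns col
    using B(3,4) qB bij_betw_imp_inj_on[OF q] by (simp add: pairwise_def inj_eq)
  have "0 < d $ i" for i
  proof -
    have "q i \<bullet> q i = 1"
      using B(4) qB by (simp add: dot_square_norm)
    moreover from this have "q i \<noteq> 0" by auto
    ultimately show ?thesis
      using A(2)[of "q i"] by (simp add: c d_def)
  qed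
  moreover have "A ** Q = Q ** diag_mat d"
  proof -
    have "(A ** Q) $ i $ j = (Q ** diag_mat d) $ i $ j" for i j
    proof -
      have "(A ** Q) $ i $ j = (A *v q j) $ i"
        by (simp add: matrix_matrix_mult_def matrix_vector_mult_def Q_def)
      then show ?thesis
        by (simp add: c matrix_mul_diag_mat_nth d_def Q_def)
    qed
    then show ?thesis
      by (simp add: vec_eq_iff)
  qed
  then have "A = Q ** diag_mat d ** transpose Q"
    using Q by (metis matrix_mul_assoc matrix_mul_rid orthogonal_matrix_def)
  ultimately show ?thesis
    using Q by blast
qed

section \<open>Determinants, real powers and the geometric mean\<close>

lemma det_orthogonal_conj:
  fixes Q A :: "real^'n::finite^'n"
  assumes "orthogonal_matrix Q"
  shows "det (Q ** A ** transpose Q) = det A"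
  using det_orthogonal_matrix[OF assms] by (auto simp: det_mul)

lemma det_pd_matrix_pos: "pd_matrix A \<Longrightarrow> 0 < det A"
  using pd_matrix_spectral[of A] by (auto simp: det_orthogonal_conj det_diag_mat intro!: prod_pos)

text \<open>Existence of a spectral decomposition makes the choice in \<open>mat_powr\<close>
  meaningful. Positivity and the determinant of the power are then read off the chosen
  \<open>Q\<close> and \<open>d\<close>.\<close>

lemma mat_powr_spectral:
  fixes A :: "real^'n::finite^'n"
  assumes "pd_matrix A"
  shows "\<exists>Q d. orthogonal_matrix Q \<and> (\<forall>i. 0 < d $ i) \<and> A = Q ** diag_mat d ** transpose Q \<and>
    mat_powr A t = Q ** diag_mat (\<chi> i. d $ i powr t) ** transpose Q"
  unfolding mat_powr_def by (rule someI_ex) (use pd_matrix_spectral[OF assms] in blast)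

lemma pd_mat_powr:
  fixes A :: "real^'n::finite^'n"
  assumes "pd_matrix A"
  shows "pd_matrix (mat_powr A t)"
proof -
  obtain Q and d :: "real^'n" where "orthogonal_matrix Q" "\<forall>i. 0 < d $ i"
    "mat_powr A t = Q ** diag_mat (\<chi> i. d $ i powr t) ** transpose Q"
    using mat_powr_spectral[OF assms] by blast
  moreover from this have "pd_matrix (diag_mat (\<chi> i. d $ i powr t))"
    by (intro pd_diag_mat) (simp add: less_imp_neq[symmetric])
  ultimately show ?thesis
    by (simp add: pd_matrix_congruence orthogonal_matrix_imp_invertible)
qed

lemma det_mat_powr:
  fixes A :: "real^'n::finite^'n"
  assumes "pd_matrix A"
  shows "det (mat_powr A t) = det A powr t"
  using mat_powr_spectral[OF assms, of t]
  by (auto simp: det_orthogonal_conj det_diag_mat prod_powr_distrib less_imp_le)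

lemma pd_matrix_invertible: "pd_matrix A \<Longrightarrow> invertible A"
  using det_pd_matrix_pos[of A] by (simp add: invertible_det_nz)

lemma pd_matrix_mult_mult:
  assumes "pd_matrix P" "pd_matrix B"
  shows "pd_matrix (P ** B ** P)"
  using pd_matrix_congruence[OF assms(2) pd_matrix_invertible[OF assms(1)]] assms(1)
  by (simp add: pd_matrix_iff)

lemma pd_geo_mean:
  assumes "pd_matrix A" "pd_matrix B"
  shows "pd_matrix (geo_mean A t B)"
  unfolding geo_mean_def by (intro pd_matrix_mult_mult pd_mat_powr assms)

text \<open>The determinant is multiplicative and turns matrix powers into scalar powers, so the
  formula reduces to the weighted geometric mean of two positive numbers.\<close>

lemma det_geo_mean:
  assumes "pd_matrix A" "pd_matrix B"
  shows "det (geo_mean A t B) = det A powr (1 - t) * det B powr t"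
proof -
  let ?M = "mat_powr A (-1/2) ** B ** mat_powr A (-1/2)"
  have pos: "det A > 0" "det B > 0"
    using assms by (auto intro: det_pd_matrix_pos)
  have "pd_matrix ?M"
    by (intro pd_matrix_mult_mult pd_mat_powr assms)
  then have "det (geo_mean A t B) = det A powr (1/2) * (det A powr (-1/2) * det B * det A powr (-1/2)) powr t * det A powr (1/2)"
    by (simp only: geo_mean_def det_mul det_mat_powr assms)
  also have "\<dots> = det A powr (1 - t) * det B powr t"
  proof -
    have "(det A powr (-1/2) * det B * det A powr (-1/2)) powr t = det B powr t * det A powr (-t)"
      using pos by (simp add: powr_divide powr_minus_divide mult_ac flip: powr_add)
    moreover have "det A powr (1/2) * det A powr (-t) * det A powr (1/2) = det A powr (1 - t)"
      using pos by (simp flip: powr_add)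
    ultimately show ?thesis
      by (simp add: mult_ac)
  qed
  finally show ?thesis .
qed

section \<open>Simultaneous diagonalisation and the trace integral\<close>

text \<open>Factor \<open>A = L ** transpose L\<close>, pull \<open>B\<close> back by the inverse
  \<open>M\<close> of \<open>L\<close>, and diagonalise the result by an orthogonal
  \<open>R\<close>. Then \<open>K = L ** R\<close> works, since \<open>R\<close> cancels in
  \<open>K ** transpose K\<close>.\<close>

lemma pd_matrix_simultaneous_diagonalization:
  fixes A B :: "real^'n::finite^'n"
  assumes "pd_matrix A" "pd_matrix B"
  shows "\<exists>(K::real^'n^'n) d. invertible K \<and> (\<forall>i. 0 < d $ i) \<and> A = K ** transpose K \<and> B = K ** diag_mat d ** transpose K"
proof -
  obtain Q e where Q: "orthogonal_matrix Q" "\<forall>i. 0 < e $ i" "A = Q ** diag_mat e ** transpose Q"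
    using pd_matrix_spectral[OF assms(1)] by blast
  define L where "L = Q ** diag_mat (\<chi> i. sqrt (e $ i))"
  have e: "diag_mat (\<chi> i. sqrt (e $ i)) ** diag_mat (\<chi> i. sqrt (e $ i)) = diag_mat e"
    using Q(2) by (simp add: diag_mat_mult less_imp_le)
  have A: "A = L ** transpose L"
    unfolding Q(3) e[symmetric] by (simp add: L_def matrix_transpose_mul matrix_mul_assoc)
  have "invertible L"
    using Q(2) unfolding L_def
    by (intro invertible_mult orthogonal_matrix_imp_invertible Q pd_matrix_invertible pd_diag_mat) auto
  then obtain M where M: "L ** M = mat 1" "M ** L = mat 1"
    by (auto simp: invertible_def)
  then have M': "transpose M ** transpose L = mat 1"
    by (metis matrix_transpose_mul transpose_mat)
  have "invertible M"
    using M by (auto simp: invertible_def)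
  from pd_matrix_congruence[OF assms(2) this] pd_matrix_spectral
  obtain R d where R: "orthogonal_matrix R" "\<forall>i. 0 < d $ i" "M ** B ** transpose M = R ** diag_mat d ** transpose R"
    by blast
  have "B = (L ** M) ** B ** (transpose M ** transpose L)"
    by (simp add: M M')
  also have "\<dots> = L ** (M ** B ** transpose M) ** transpose L"
    by (simp add: matrix_mul_assoc)
  also have "\<dots> = (L ** R) ** diag_mat d ** transpose (L ** R)"
    by (simp add: R matrix_transpose_mul matrix_mul_assoc)
  finally have "B = (L ** R) ** diag_mat d ** transpose (L ** R)" .
  moreover have "A = (L ** R) ** transpose (L ** R)"
    using R(1) by (simp add: A matrix_transpose_mul orthogonal_matrix_def)
      (metis matrix_mul_assoc matrix_mul_rid)
  moreover have "invertible (L ** R)"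
    using R(1) \<open>invertible L\<close> by (simp add: invertible_mult orthogonal_matrix_imp_invertible)
  ultimately show ?thesis
    using R(2) by blast
qed

text \<open>The integrand is the derivative of the log-determinant along the segment. A common
  congruence splits it into scalar logarithmic derivatives.\<close>

lemma integral_trace_inverse_segment:
  fixes A B :: "real^'n::finite^'n"
  assumes "pd_matrix A" "pd_matrix B"
  shows "integral {0..1} (\<lambda>l. trace (matrix_inv ((1 - l) *\<^sub>R A + l *\<^sub>R B) ** (B - A))) = ln (det B) - ln (det A)"
proof -
  obtain K :: "real^'n^'n" and d where K: "invertible K" and d: "\<And>i. 0 < d $ i"
    and A: "A = K ** transpose K" and B: "B = K ** diag_mat d ** transpose K"
    using pd_matrix_simultaneous_diagonalization[OF assms] by blast
  obtain M where M: "K ** M = mat 1" "M ** K = mat 1"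
    using K by (auto simp: invertible_def)
  then have M': "transpose M ** transpose K = mat 1" "transpose K ** transpose M = mat 1"
    by (metis matrix_transpose_mul transpose_mat)+
  \<comment> \<open>A convex combination of 1 and \<open>d $ i\<close> is positive on the closed
    interval, so the inverse exists and the logarithms are differentiable up to both
    endpoints.\<close>
  have pos: "0 < 1 - l + l * d $ i" if "l \<in> {0..1}" for l i
    using that d[of i] by (cases "l = 0") (auto intro: add_nonneg_pos)
  have tr: "trace (matrix_inv ((1 - l) *\<^sub>R A + l *\<^sub>R B) ** (B - A))
      = (\<Sum>i\<in>UNIV. (d $ i - 1) / (1 - l + l * d $ i))" if "l \<in> {0..1}" for l
  proof -
    define e where "e = (\<chi> i. 1 - l + l * d $ i)"
    define e' where "e' = (\<chi> i. 1 / e $ i)"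
    \<comment> \<open>General coefficients cover both uses: \<open>1 - l\<close> and
      \<open>l\<close> for the point on the segment, \<open>-1\<close> and \<open>1\<close> for
      \<open>B - A\<close>.\<close>
    have lin: "a *\<^sub>R A + b *\<^sub>R B = K ** diag_mat (\<chi> i. a + b * d $ i) ** transpose K" for a b
    proof -
      have "diag_mat (\<chi> i. a + b * d $ i) = a *\<^sub>R mat 1 + b *\<^sub>R diag_mat d"
        by (simp add: vec_eq_iff diag_mat_def mat_def)
      then show ?thesis
        by (simp add: A B matrix_add_ldistrib matrix_mul_add_left matrix_mul_scaleR scaleR_matrix_mul)
    qed
    have ee: "diag_mat e ** diag_mat e' = mat 1"
      using pos[OF that] unfolding diag_mat_mult diag_mat_1[symmetric]
      by (intro arg_cong[of _ _ diag_mat]) (simp add: vec_eq_iff e'_def e_def less_imp_neq[symmetric])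
    have "K ** diag_mat e ** transpose K ** (transpose M ** diag_mat e' ** M)
        = K ** diag_mat e ** (transpose K ** transpose M) ** diag_mat e' ** M"
      by (simp add: matrix_mul_assoc)
    also have "\<dots> = K ** (diag_mat e ** diag_mat e') ** M"
      by (simp add: M' matrix_mul_assoc)
    finally have "matrix_inv (K ** diag_mat e ** transpose K) = transpose M ** diag_mat e' ** M"
      by (intro matrix_inv_eqI) (simp add: ee M)
    then have "matrix_inv ((1 - l) *\<^sub>R A + l *\<^sub>R B) = transpose M ** diag_mat e' ** M"
      by (simp add: lin e_def)
    moreover have "B - A = K ** diag_mat (\<chi> i. d $ i - 1) ** transpose K"
      using lin[of "-1" 1] by simp
    ultimately have "trace (matrix_inv ((1 - l) *\<^sub>R A + l *\<^sub>R B) ** (B - A))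
        = trace (transpose M ** diag_mat e' ** (M ** K) ** diag_mat (\<chi> i. d $ i - 1) ** transpose K)"
      by (simp add: matrix_mul_assoc)
    \<comment> \<open>Cyclicity of the trace brings \<open>transpose K\<close> next to
      \<open>transpose M\<close>, which cancels the remaining congruence factors.\<close>
    also have "\<dots> = trace (transpose K ** (transpose M ** diag_mat e' ** diag_mat (\<chi> i. d $ i - 1)))"
      by (subst trace_mul_sym) (simp add: M)
    also have "\<dots> = trace (diag_mat e' ** diag_mat (\<chi> i. d $ i - 1))"
      by (simp add: matrix_mul_assoc M')
    finally show ?thesis
      by (simp add: diag_mat_mult trace_diag_mat e'_def e_def)
  qed
  \<comment> \<open>The antiderivative is the sum of \<open>ln (1 - l + l * d $ i)\<close>, with the
    endpoints 1 and 0 substituted unsimplified to match the fundamental theorem; the terms at 0 are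
    \<open>ln 1\<close>.\<close>
  have "((\<lambda>l. \<Sum>i\<in>UNIV. (d $ i - 1) / (1 - l + l * d $ i)) has_integral
      (\<Sum>i\<in>UNIV. ln (1 - 1 + 1 * d $ i)) - (\<Sum>i\<in>UNIV. ln (1 - 0 + 0 * d $ i))) {0..1}"
    using pos
    by (intro fundamental_theorem_of_calculus)
      (auto intro!: derivative_eq_intros simp: has_real_derivative_iff_has_vector_derivative[symmetric])
  then have "integral {0..1} (\<lambda>l. \<Sum>i\<in>UNIV. (d $ i - 1) / (1 - l + l * d $ i)) = (\<Sum>i\<in>UNIV. ln (d $ i))"
    by (simp add: integral_unique)
  moreover have "ln (det B) = ln (det A) + (\<Sum>i\<in>UNIV. ln (d $ i))"
  proof -
    have "det B = det A * (\<Prod>i\<in>UNIV. d $ i)"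
      by (simp add: A B det_mul det_diag_mat)
    moreover have "d $ i \<noteq> 0" for i
      using d[of i] by simp
    ultimately show ?thesis
      using d det_pd_matrix_pos[OF assms(1)] by (simp add: ln_mult ln_prod prod_pos)
  qed
  moreover have "integral {0..1} (\<lambda>l. trace (matrix_inv ((1 - l) *\<^sub>R A + l *\<^sub>R B) ** (B - A)))
      = integral {0..1} (\<lambda>l. \<Sum>i\<in>UNIV. (d $ i - 1) / (1 - l + l * d $ i))"
    by (rule integral_cong) (rule tr)
  ultimately show ?thesis by simp
qed

section \<open>Entropy of Gaussian densities\<close>

lemma matrix_inv_mat_1: "matrix_inv (mat 1 :: real^'n::finite^'n) = mat 1"
  by (simp add: matrix_inv_eqI)

lemma integrable_gauss_density_mat_1:
  "integrable lborel (gauss_density (mat 1 :: real^'n::finite^'n))"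
  using has_bochner_integral_gaussian[of "1/2", where 'a="real^'n"]
  unfolding gauss_density_def
  by (intro integrable_mult_right) (simp add: matrix_inv_mat_1 has_bochner_integral_iff)

lemma integral_gauss_density_mat_1:
  "integral\<^sup>L lborel (gauss_density (mat 1 :: real^'n::finite^'n)) = 1"
proof -
  have "(\<integral>x. exp (- (1/2) * (x \<bullet> x)) \<partial>(lborel :: (real^'n) measure)) = sqrt (2 * pi) ^ CARD('n)"
    using has_bochner_integral_gaussian[of "1/2", where 'a="real^'n"]
    by (simp add: has_bochner_integral_iff mult.commute)
  also have "\<dots> = (2 * pi) powr (real CARD('n) / 2)"
    by (simp add: powr_half_sqrt[symmetric] powr_powr flip: powr_realpow)
  finally show ?thesis
    unfolding gauss_density_def by (simp add: matrix_inv_mat_1 flip: powr_add)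
qed

text \<open>The logarithm of the density is a constant minus half of \<open>x \<bullet> x\<close>,
  so a second moment has to be finite. It is dominated by the wider Gaussian with exponent
  \<open>- (1/4) * (x \<bullet> x)\<close>. The result later allows the entropy integral to be
  split.\<close>

lemma integrable_gauss_density_mat_1_ln:
  "integrable lborel (\<lambda>x. gauss_density (mat 1 :: real^'n::finite^'n) x * ln (gauss_density (mat 1) x))"
proof -
  define c where "c = (2 * pi) powr (- real CARD('n) / 2)"
  have "c > 0" by (simp add: c_def)
  have g: "gauss_density (mat 1 :: real^'n^'n) x = c * exp (- (1/2) * (x \<bullet> x))" for x
    by (simp add: gauss_density_def c_def matrix_inv_mat_1)
  have "integrable lborel (\<lambda>x::real^'n. exp (- (1/2) * (x \<bullet> x)) * (x \<bullet> x))"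
  proof (rule Bochner_Integration.integrable_bound)
    show "integrable lborel (\<lambda>x::real^'n. 4 * exp (- (1/4) * (x \<bullet> x)))"
      using has_bochner_integral_gaussian[of "1/4", where 'a="real^'n"]
      by (intro integrable_mult_right) (simp add: has_bochner_integral_iff)
    show "AE x :: real^'n in lborel. norm (exp (- (1/2) * (x \<bullet> x)) * (x \<bullet> x)) \<le> norm (4 * exp (- (1/4) * (x \<bullet> x)))"
    proof (rule AE_I2)
      fix x :: "real^'n"
      have "exp (- (1/2) * (x \<bullet> x)) * (x \<bullet> x) \<le> exp (- (1/2) * (x \<bullet> x)) * (4 * exp ((1/4) * (x \<bullet> x)))"
      proof (rule mult_left_mono)
        \<comment> \<open>This is \<open>u + 1 \<le> exp u\<close> at a quarter of
          \<open>x \<bullet> x\<close>; half of the Gaussian decay absorbs the factor.\<close>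
        show "x \<bullet> x \<le> 4 * exp ((1/4) * (x \<bullet> x))"
          using exp_ge_add_one_self[of "(1/4) * (x \<bullet> x)"] by linarith
      qed simp
      also have "\<dots> = 4 * exp (- (1/4) * (x \<bullet> x))"
        by (simp flip: exp_add)
      finally show "norm (exp (- (1/2) * (x \<bullet> x)) * (x \<bullet> x)) \<le> norm (4 * exp (- (1/4) * (x \<bullet> x)))"
        by simp
    qed
  qed measurable
  then have "integrable lborel (\<lambda>x::real^'n. ln c * gauss_density (mat 1) x
      - c / 2 * (exp (- (1/2) * (x \<bullet> x)) * (x \<bullet> x)))"
    by (intro Bochner_Integration.integrable_diff integrable_mult_right integrable_gauss_density_mat_1)
  moreover have "gauss_density (mat 1) x * ln (gauss_density (mat 1) x)
      = ln c * gauss_density (mat 1) x - c / 2 * (exp (- (1/2) * (x \<bullet> x)) * (x \<bullet> x))" for x :: "real^'n"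
    using \<open>c > 0\<close> by (simp add: g ln_mult algebra_simps)
  ultimately show ?thesis by simp
qed

section \<open>Change of variables and the entropy formula\<close>

text \<open>Substitution \<open>Q *v (diag_mat s *v x)\<close> with Jacobian the product of the
  \<open>s $ i\<close>: the rotation preserves Lebesgue measure, and the diagonal part is a
  coordinatewise scaling.\<close>

lemma integral_lborel_orthogonal_diag:
  fixes Q :: "real^'n::finite^'n" and s :: "real^'n" and h :: "real^'n \<Rightarrow> real"
  assumes Q: "orthogonal_matrix Q" and s: "\<And>i. 0 < s $ i" and [measurable]: "h \<in> borel_measurable borel"
  shows "integral\<^sup>L lborel h = (\<Prod>i\<in>UNIV. s $ i) * (\<integral>x. h (Q *v (diag_mat s *v x)) \<partial>lborel)"
proof -
  have [measurable]: "(*v) A \<in> borel_measurable borel" for A :: "real^'n^'n"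
    by (intro borel_measurable_continuous_onI linear_continuous_on
        linear_conv_bounded_linear[THEN iffD1] matrix_vector_mul_linear)
  have "integral\<^sup>L lborel h = integral\<^sup>L (distr lborel borel ((*v) Q)) h"
    using Q by (simp add: distr_lborel_orthogonal_transformation orthogonal_transformation_matrix
        matrix_of_matrix_vector_mul matrix_vector_mul_linear)
  also have "\<dots> = (\<integral>x. h (Q *v x) \<partial>lborel)"
    by (simp add: integral_distr)
  also have "\<dots> = (\<Prod>i\<in>UNIV. s $ i) * (\<integral>x. h (Q *v (diag_mat s *v x)) \<partial>lborel)"
  proof -
    have diag: "(\<Sum>j\<in>Basis. ((s \<bullet> j) * (x \<bullet> j)) *\<^sub>R j) = diag_mat s *v x" for x :: "real^'n"
    proof (rule euclidean_eqI)
      fix b :: "real^'n" assume b: "b \<in> Basis"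
      then obtain i where "b = axis i 1"
        by (auto simp: Basis_vec_def)
      then have "(s \<bullet> b) * (x \<bullet> b) = (diag_mat s *v x) \<bullet> b"
        by (simp add: inner_axis diag_mat_mult_vector_nth)
      then show "(\<Sum>j\<in>Basis. ((s \<bullet> j) * (x \<bullet> j)) *\<^sub>R j) \<bullet> b = (diag_mat s *v x) \<bullet> b"
        using b by simp
    qed
    have "(\<Prod>j\<in>Basis. \<bar>s \<bullet> j\<bar>) = (\<Prod>i\<in>UNIV. \<bar>s \<bullet> axis i 1\<bar>)"
      by (rule prod.reindex_cong[of "\<lambda>i. axis i 1"]) (auto simp: Basis_vec_def inj_on_def axis_eq_axis)
    also have "\<dots> = (\<Prod>i\<in>UNIV. s $ i)"
      using s by (simp add: inner_axis less_imp_le)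
    finally have prod: "(\<Prod>j\<in>Basis. \<bar>s \<bullet> j\<bar>) = (\<Prod>i\<in>UNIV. s $ i)" .
    have "s \<bullet> j \<noteq> 0" if "j \<in> Basis" for j
      using that s by (auto simp: Basis_vec_def inner_axis less_imp_neq[symmetric])
    from lborel_affine_euclidean[of "\<lambda>j. s \<bullet> j" 0, OF this]
    have "lborel = density (distr lborel borel ((*v) (diag_mat s))) (\<lambda>_. ennreal (\<Prod>i\<in>UNIV. s $ i))"
      by (simp add: diag prod)
    \<comment> \<open>Only the outer measure is replaced: \<open>lborel\<close> occurs again inside
      the right side, so the equation would loop as a rewrite rule.\<close>
    then have "(\<integral>x. h (Q *v x) \<partial>lborel) = (\<integral>x. h (Q *v x)
        \<partial>density (distr lborel borel ((*v) (diag_mat s))) (\<lambda>_. ennreal (\<Prod>i\<in>UNIV. s $ i)))"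
      by (rule arg_cong)
    also have "\<dots> = (\<Prod>i\<in>UNIV. s $ i) * (\<integral>x. h (Q *v (diag_mat s *v x)) \<partial>lborel)"
      using s by (subst integral_density) (auto simp: integral_distr prod_nonneg less_imp_le)
    finally show ?thesis .
  qed
  finally show ?thesis .
qed

text \<open>The substitution turns the density into \<phi> divided by the Jacobian \<open>D\<close>.
  The Jacobian cancels this factor outside the logarithm; inside it, total mass 1 leaves
  \<open>ln D\<close>, half of \<open>ln (det S)\<close>. The standard entropy stays symbolic: it
  cancels in differences and is preserved by weights summing to 1.\<close>

lemma entropy_gauss_density:
  fixes S :: "real^'n::finite^'n"
  assumes "pd_matrix S"
  shows "entropy (gauss_density S) = entropy (gauss_density (mat 1 :: real^'n^'n)) + ln (det S) / 2"
proof -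
  obtain Q d where Q: "orthogonal_matrix Q" and d: "\<And>i. 0 < d $ i" and S: "S = Q ** diag_mat d ** transpose Q"
    using pd_matrix_spectral[OF assms] by blast
  define s where "s = (\<chi> i. sqrt (d $ i))"
  have s: "0 < s $ i" for i
    using d by (simp add: s_def)
  define D where "D = (\<Prod>i\<in>UNIV. s $ i)"
  define \<phi> where "\<phi> = gauss_density (mat 1 :: real^'n^'n)"
  have "D > 0"
    using s by (auto simp: D_def intro: prod_pos)
  have det: "det S = D\<^sup>2"
    using d by (simp add: S det_orthogonal_conj[OF Q] det_diag_mat D_def s_def less_imp_le prod_power_distrib)
  have QQ: "transpose Q ** Q = mat 1" "Q ** transpose Q = mat 1"
    using Q by (auto simp: orthogonal_matrix_def)
  let ?e = "diag_mat (\<chi> i. 1 / d $ i)"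
  have "S ** (Q ** ?e ** transpose Q) = Q ** diag_mat d ** (transpose Q ** Q) ** ?e ** transpose Q"
    by (simp add: S matrix_mul_assoc)
  also have "\<dots> = Q ** (diag_mat d ** ?e) ** transpose Q"
    by (simp add: QQ matrix_mul_assoc)
  also have "diag_mat d ** ?e = mat 1"
    using d by (simp add: diag_mat_mult less_imp_neq[symmetric] diag_mat_1)
  finally have inv: "matrix_inv S = Q ** ?e ** transpose Q"
    by (intro matrix_inv_eqI) (simp add: QQ)
  \<comment> \<open>The scaling by \<open>sqrt (d $ i)\<close> is chosen to undo the eigenvalues
    \<open>1 / d $ i\<close> of the inverse, so the exponent becomes that of the standard
    Gaussian.\<close>
  have quad: "(Q *v (diag_mat s *v x)) \<bullet> (matrix_inv S *v (Q *v (diag_mat s *v x))) = x \<bullet> x" for x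
  proof -
    let ?y = "diag_mat s *v x"
    have "matrix_inv S *v (Q *v ?y) = Q *v (?e *v ((transpose Q ** Q) *v ?y))"
      by (simp only: inv matrix_vector_mul_assoc matrix_mul_assoc)
    then have "(Q *v ?y) \<bullet> (matrix_inv S *v (Q *v ?y)) = (transpose Q *v (Q *v ?y)) \<bullet> (?e *v ?y)"
      by (simp only: QQ matrix_vector_mul_lid inner_matrix_vector_transpose[of _ Q])
    also have "transpose Q *v (Q *v ?y) = ?y"
      by (simp only: QQ matrix_vector_mul_lid matrix_vector_mul_assoc[of "transpose Q"])
    also have "?y \<bullet> (?e *v ?y) = (\<Sum>i\<in>UNIV. (s $ i)\<^sup>2 / d $ i * (x $ i * x $ i))"
      by (simp add: inner_vec_def diag_mat_mult_vector_nth power2_eq_square mult_ac)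
    also have "\<dots> = x \<bullet> x"
      using d by (simp add: s_def inner_vec_def less_imp_le less_imp_neq[symmetric])
    finally show ?thesis .
  qed
  have "det S powr (-1/2) = 1 / D"
    using \<open>D > 0\<close> by (simp add: det powr_minus_divide powr_half_sqrt)
  then have g: "gauss_density S (Q *v (diag_mat s *v x)) = \<phi> x / D" for x
    by (simp add: gauss_density_def quad \<phi>_def matrix_inv_mat_1)
  have \<phi>_pos: "\<phi> x > 0" for x
    by (simp add: \<phi>_def gauss_density_def)
  have cont: "continuous_on UNIV (\<lambda>x. x \<bullet> (matrix_inv S *v x))"
    by (intro continuous_intros)
  have [measurable]: "gauss_density S \<in> borel_measurable borel"
    unfolding gauss_density_def
    by (intro borel_measurable_continuous_onI continuous_intros cont)
  have int: "integrable lborel \<phi>" "integral\<^sup>L lborel \<phi> = 1" "integrable lborel (\<lambda>x. \<phi> x * ln (\<phi> x))"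
    unfolding \<phi>_def by (rule integrable_gauss_density_mat_1 integral_gauss_density_mat_1 integrable_gauss_density_mat_1_ln)+
  have "entropy (gauss_density S) = - (D * (\<integral>x. \<phi> x / D * ln (\<phi> x / D) \<partial>lborel))"
    unfolding entropy_def
    by (subst integral_lborel_orthogonal_diag[OF Q s]) (simp_all add: g D_def)
  also have "(\<integral>x. \<phi> x / D * ln (\<phi> x / D) \<partial>lborel) = (\<integral>x. (\<phi> x * ln (\<phi> x) - ln D * \<phi> x) / D \<partial>lborel)"
    using \<open>D > 0\<close> \<phi>_pos by (intro Bochner_Integration.integral_cong) (simp_all add: ln_div field_simps)
  also have "\<dots> = ((\<integral>x. \<phi> x * ln (\<phi> x) \<partial>lborel) - ln D) / D"
    using int by simp
  finally have "entropy (gauss_density S) = entropy \<phi> + ln D"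
    using \<open>D > 0\<close> by (simp add: entropy_def)
  moreover have "ln (det S) = 2 * ln D"
    using \<open>D > 0\<close> by (simp add: det ln_realpow)
  ultimately show ?thesis
    by (simp add: \<phi>_def)
qed

section \<open>The two entropy identities\<close>

theorem theorem6p5:
  fixes E :: "('n::finite \<times> 'n) set"
    and Sig Sig0 Sig1 :: "real^'n^'n"
  assumes "is_graph E"
    and "completable E"
    and "partial_pd E Sig"
    and "Sig0 \<in> pd_completions E Sig"
    and "Sig1 \<in> pd_completions E Sig"
  shows "entropy (gauss_density Sig1) - entropy (gauss_density Sig0) =
           (1/2) * integral {0..1} (\<lambda>l. trace (matrix_inv ((1 - l) *\<^sub>R Sig0 + l *\<^sub>R Sig1) ** (Sig1 - Sig0)))
         \<and> (\<forall>t\<in>{0..1::real}. entropy (gauss_density (geo_mean Sig0 t Sig1)) =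
               (1 - t) * entropy (gauss_density Sig0) + t * entropy (gauss_density Sig1))"
proof -
  have pd: "pd_matrix Sig0" "pd_matrix Sig1"
    using assms(4,5) by (auto simp: pd_completions_def)
  then have pos: "0 < det Sig0" "0 < det Sig1"
    by (auto intro: det_pd_matrix_pos)
  have "ln (det (geo_mean Sig0 t Sig1)) = (1 - t) * ln (det Sig0) + t * ln (det Sig1)" for t
    using pos by (simp add: det_geo_mean[OF pd] ln_mult ln_powr)
  then show ?thesis
    \<comment> \<open>Once each entropy is the standard one plus half a log-determinant, both claims
      are linear identities in the two log-determinants and that constant.\<close>
    by (simp only: entropy_gauss_density pd pd_geo_mean integral_trace_inverse_segment)
      (simp add: field_simps)
qed

end
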